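(* Let $M$ be a smooth manifold and let $E\to M$ be a vector bundle equipped with a Loday algebroid structure, with bracket $[\cdot,\cdot]$ on the space $\Gamma E$ of global smooth sections, left anchor $a_l:E\to TM$ and right anchor $a_r:E\to TM$. Then $a_l=a_r$, and the bracket is skew-symmetric at points where the anchors do not vanish; that is, for every $p\in M$ such that the linear map $(a_l)_p=(a_r)_p:E_p\to T_pM$ is nonzero, one has $[X,Y](p)=-[Y,X](p)$ for all $X,Y\in\Gamma E$.
   Context: All manifolds, bundles, sections and functions are smooth and real. An algebroid on a manifold $M$ is a vector bundle $\tau:E\to M$ together with an $\mathbb{R}$-bilinear bracket $[\cdot,\cdot]:\Gamma E\times\Gamma E\to\Gamma E$ on the $C^\infty(M)$-module $\Gamma E$ of global sections of $E$, and two vector bundle morphisms $a_l,a_r:E\to TM$ over the identity of $M$ (the left and right anchors), such that $$[fX,gY]=fg[X,Y]+f\,a_l(X)(g)\,Y-g\,a_r(Y)(f)\,X$$ for all $X,Y\in\Gamma E$ and all $f,g\in C^\infty(M)$. Here $a_l(X)(g)$ denotes the derivative of $g$ along the vector field $a_l(X)$, and similarly for $a_r$. No skew-symmetry is assumed. A Loday algebroid is an algebroid whose bracket satisfies the Jacobi identity in the form $$[X,[Y,Z]]=[[X,Y],Z]+[Y,[X,Z]]\qquad\text{for all }X,Y,Z\in\Gamma E.$$ A Loday algebroid bracket is the bracket of such a structure. *)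

theory Defs
  imports "HOL-Analysis.Analysis"
begin

text \<open>Smooth maps between normed spaces. These are only used on open sets of finite-dimensional
  spaces, where continuity of all iterated directional derivatives is the usual notion.\<close>

primrec Ck_on ::
  "nat \<Rightarrow> 'a::real_normed_vector set \<Rightarrow> ('a \<Rightarrow> 'b::real_normed_vector) \<Rightarrow> bool" where
  "Ck_on 0 S f \<longleftrightarrow> continuous_on S f"
| "Ck_on (Suc k) S f \<longleftrightarrow> (\<forall>x\<in>S. f differentiable (at x)) \<and>
     (\<forall>v. Ck_on k S (\<lambda>x. frechet_derivative f (at x) v))"

definition smooth_on :: "'a::real_normed_vector set \<Rightarrow> ('a \<Rightarrow> 'b::real_normed_vector) \<Rightarrow> bool" where
  "smooth_on S f \<longleftrightarrow> (\<forall>k. Ck_on k S f)"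

text \<open>The model spaces of manifolds and of fibres are finite-dimensional inner product spaces
  rather than types of class \<^class>\<open>euclidean_space\<close>, because the latter have dimension at
  least one, which would exclude zero-dimensional manifolds and bundles of rank zero.\<close>

definition finite_dimensional :: "'a::real_vector itself \<Rightarrow> bool" where
  "finite_dimensional _ \<longleftrightarrow> (\<exists>B :: 'a set. finite B \<and> span B = UNIV)"

text \<open>A manifold is a whole type \<open>'m\<close>, Hausdorff and second countable, with a smooth atlas, not
  assumed maximal. A chart is a pair of a domain and a map, whose values outside the domain are
  irrelevant.\<close>

type_synonym ('m, 'e) chart = "'m set \<times> ('m \<Rightarrow> 'e)"

definition smooth_manifold ::
  "('m::{t2_space, second_countable_topology}, 'e::real_inner) chart set \<Rightarrow> bool" where
  "smooth_manifold A \<longleftrightarrow>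
     finite_dimensional TYPE('e) \<and>
     (\<forall>(U, \<phi>)\<in>A. open U \<and> open (\<phi> ` U) \<and> homeomorphism U (\<phi> ` U) \<phi> (inv_into U \<phi>)) \<and>
     (\<Union>(U, \<phi>)\<in>A. U) = UNIV \<and>
     (\<forall>(U, \<phi>)\<in>A. \<forall>(V, \<psi>)\<in>A. smooth_on (\<phi> ` (U \<inter> V)) (\<psi> \<circ> inv_into U \<phi>))"

definition smooth_map_on ::
  "('m::topological_space, 'e::real_inner) chart set \<Rightarrow> 'm set \<Rightarrow>
     ('m \<Rightarrow> 'b::real_normed_vector) \<Rightarrow> bool" where
  "smooth_map_on A W f \<longleftrightarrow> (\<forall>(U, \<phi>)\<in>A. smooth_on (\<phi> ` (U \<inter> W)) (f \<circ> inv_into U \<phi>))"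

definition smooth_functions ::
  "('m::topological_space, 'e::real_inner) chart set \<Rightarrow> ('m \<Rightarrow> real) set" where
  "smooth_functions A = {f. smooth_map_on A UNIV f}"

text \<open>The fibres of a vector bundle are subspaces of one ambient vector space \<open>'v\<close>, which carries
  no topology; any family of vector spaces can be presented this way, for instance inside its
  direct sum. The total space is \<open>{(p, v). v \<in> fibre E p}\<close>, and its smooth structure is the one
  given by the local trivializations, which are pairs of a domain \<open>W\<close> and a family of linear
  isomorphisms from the fibres over \<open>W\<close> to the typical fibre \<open>'f\<close>. As \<open>'f\<close> is
  finite-dimensional, a family of linear maps on it depends smoothly on the base point iff all its
  values do.\<close>

record ('m, 'v, 'f) vbundle =
  fibre :: "'m \<Rightarrow> 'v set"
  trivializations :: "('m set \<times> ('m \<Rightarrow> 'v \<Rightarrow> 'f)) set"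

definition linear_between ::
  "'v::real_vector set \<Rightarrow> 'w::real_vector set \<Rightarrow> ('v \<Rightarrow> 'w) \<Rightarrow> bool" where
  "linear_between V W h \<longleftrightarrow> h ` V \<subseteq> W \<and>
     (\<forall>u\<in>V. \<forall>v\<in>V. h (u + v) = h u + h v) \<and> (\<forall>c. \<forall>v\<in>V. h (c *\<^sub>R v) = c *\<^sub>R h v)"

definition vector_bundle ::
  "('m::topological_space, 'e::real_inner) chart set \<Rightarrow>
     ('m, 'v::real_vector, 'f::real_inner) vbundle \<Rightarrow> bool" where
  "vector_bundle A E \<longleftrightarrow>
     finite_dimensional TYPE('f) \<and>
     (\<forall>p. subspace (fibre E p)) \<and>
     (\<forall>(W, \<Phi>)\<in>trivializations E. open W \<and>
        (\<forall>p\<in>W. linear_between (fibre E p) UNIV (\<Phi> p) \<and> bij_betw (\<Phi> p) (fibre E p) UNIV)) \<and>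
     (\<Union>(W, \<Phi>)\<in>trivializations E. W) = UNIV \<and>
     (\<forall>(W, \<Phi>)\<in>trivializations E. \<forall>(W', \<Psi>)\<in>trivializations E. \<forall>v.
        smooth_map_on A (W \<inter> W') (\<lambda>p. \<Psi> p (inv_into (fibre E p) (\<Phi> p) v)))"

definition sections ::
  "('m::topological_space, 'e::real_inner) chart set \<Rightarrow>
     ('m, 'v::real_vector, 'f::real_inner) vbundle \<Rightarrow> ('m \<Rightarrow> 'v) set" where
  "sections A E = {X. (\<forall>p. X p \<in> fibre E p) \<and>
     (\<forall>(W, \<Phi>)\<in>trivializations E. smooth_map_on A W (\<lambda>p. \<Phi> p (X p)))}"

text \<open>Vector bundle morphisms over the identity of the base.\<close>

definition bundle_morphism ::
  "('m::topological_space, 'e::real_inner) chart set \<Rightarrow>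
     ('m, 'v::real_vector, 'f::real_inner) vbundle \<Rightarrow>
     ('m, 'w::real_vector, 'g::real_inner) vbundle \<Rightarrow> ('m \<Rightarrow> 'v \<Rightarrow> 'w) \<Rightarrow> bool" where
  "bundle_morphism A E F a \<longleftrightarrow>
     (\<forall>p. linear_between (fibre E p) (fibre F p) (a p)) \<and>
     (\<forall>(W, \<Phi>)\<in>trivializations E. \<forall>(W', \<Psi>)\<in>trivializations F. \<forall>v.
        smooth_map_on A (W \<inter> W') (\<lambda>p. \<Psi> p (a p (inv_into (fibre E p) (\<Phi> p) v))))"

text \<open>A tangent vector at \<open>p\<close> is determined by its components in one chart around \<open>p\<close>. It is
  represented here by its components in the chart \<open>chart_at A p\<close>, chosen once for every point. The
  components in another chart are obtained from the Jacobian of the coordinate change; they are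
  the local trivializations of the tangent bundle.\<close>

definition chart_at :: "('m, 'e) chart set \<Rightarrow> 'm \<Rightarrow> ('m, 'e) chart" where
  "chart_at A p = (SOME c. c \<in> A \<and> p \<in> fst c)"

definition tangent_map ::
  "('m, 'e::real_inner) chart set \<Rightarrow> 'm \<Rightarrow> ('m \<Rightarrow> 'b::real_normed_vector) \<Rightarrow> 'e \<Rightarrow> 'b" where
  "tangent_map A p f =
     (case chart_at A p of (U, \<phi>) \<Rightarrow> frechet_derivative (f \<circ> inv_into U \<phi>) (at (\<phi> p)))"

definition tangent_bundle :: "('m, 'e::real_inner) chart set \<Rightarrow> ('m, 'e, 'e) vbundle" where
  "tangent_bundle A =
     \<lparr>fibre = (\<lambda>p. UNIV), trivializations = {(U, \<lambda>p. tangent_map A p \<phi>) | U \<phi>. (U, \<phi>) \<in> A}\<rparr>"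

definition lie_derivative ::
  "('m, 'e::real_inner) chart set \<Rightarrow> ('m \<Rightarrow> 'e) \<Rightarrow> ('m \<Rightarrow> real) \<Rightarrow> 'm \<Rightarrow> real" where
  "lie_derivative A \<xi> g p = tangent_map A p g (\<xi> p)"

definition bilinear_bracket ::
  "('m \<Rightarrow> 'v::real_vector) set \<Rightarrow> (('m \<Rightarrow> 'v) \<Rightarrow> ('m \<Rightarrow> 'v) \<Rightarrow> 'm \<Rightarrow> 'v) \<Rightarrow> bool" where
  "bilinear_bracket \<Gamma> br \<longleftrightarrow>
     (\<forall>X\<in>\<Gamma>. \<forall>Y\<in>\<Gamma>. br X Y \<in> \<Gamma>) \<and>
     (\<forall>X\<in>\<Gamma>. \<forall>Y\<in>\<Gamma>. \<forall>Z\<in>\<Gamma>.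
        br (\<lambda>p. X p + Y p) Z = (\<lambda>p. br X Z p + br Y Z p) \<and>
        br Z (\<lambda>p. X p + Y p) = (\<lambda>p. br Z X p + br Z Y p)) \<and>
     (\<forall>c. \<forall>X\<in>\<Gamma>. \<forall>Y\<in>\<Gamma>.
        br (\<lambda>p. c *\<^sub>R X p) Y = (\<lambda>p. c *\<^sub>R br X Y p) \<and>
        br X (\<lambda>p. c *\<^sub>R Y p) = (\<lambda>p. c *\<^sub>R br X Y p))"

definition algebroid ::
  "('m::{t2_space, second_countable_topology}, 'e::real_inner) chart set \<Rightarrow>
     ('m, 'v::real_vector, 'f::real_inner) vbundle \<Rightarrow>
     (('m \<Rightarrow> 'v) \<Rightarrow> ('m \<Rightarrow> 'v) \<Rightarrow> 'm \<Rightarrow> 'v) \<Rightarrow>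
     ('m \<Rightarrow> 'v \<Rightarrow> 'e) \<Rightarrow> ('m \<Rightarrow> 'v \<Rightarrow> 'e) \<Rightarrow> bool" where
  "algebroid A E br al ar \<longleftrightarrow>
     vector_bundle A E \<and>
     bilinear_bracket (sections A E) br \<and>
     bundle_morphism A E (tangent_bundle A) al \<and>
     bundle_morphism A E (tangent_bundle A) ar \<and>
     (\<forall>X\<in>sections A E. \<forall>Y\<in>sections A E. \<forall>f\<in>smooth_functions A. \<forall>g\<in>smooth_functions A.
        br (\<lambda>p. f p *\<^sub>R X p) (\<lambda>p. g p *\<^sub>R Y p) =
          (\<lambda>p. (f p * g p) *\<^sub>R br X Y p
             + (f p * lie_derivative A (\<lambda>q. al q (X q)) g p) *\<^sub>R Y p
             - (g p * lie_derivative A (\<lambda>q. ar q (Y q)) f p) *\<^sub>R X p))"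

definition loday_algebroid ::
  "('m::{t2_space, second_countable_topology}, 'e::real_inner) chart set \<Rightarrow>
     ('m, 'v::real_vector, 'f::real_inner) vbundle \<Rightarrow>
     (('m \<Rightarrow> 'v) \<Rightarrow> ('m \<Rightarrow> 'v) \<Rightarrow> 'm \<Rightarrow> 'v) \<Rightarrow>
     ('m \<Rightarrow> 'v \<Rightarrow> 'e) \<Rightarrow> ('m \<Rightarrow> 'v \<Rightarrow> 'e) \<Rightarrow> bool" where
  "loday_algebroid A E br al ar \<longleftrightarrow>
     algebroid A E br al ar \<and>
     (\<forall>X\<in>sections A E. \<forall>Y\<in>sections A E. \<forall>Z\<in>sections A E.
        br X (br Y Z) = (\<lambda>p. br (br X Y) Z p + br Y (br X Z) p))"

end

theory Submission
  imports Defs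
begin

text \<open>
  Write \<open>l\<^sub>X\<close> and \<open>r\<^sub>X\<close> for the derivatives along \<open>al X\<close> and \<open>ar X\<close>. The argument consists in
  replacing one argument of the Jacobi identity by a function multiple and comparing
  coefficients.

  Scaling \<open>Z\<close> in \<open>[X, [Y, Z]]\<close> shows that the left anchor is a homomorphism,
  \<open>l\<^bsub>[X, Y]\<^esub> = l\<^sub>X l\<^sub>Y - l\<^sub>Y l\<^sub>X\<close> (\<open>left_anchor_hom\<close>). Replacing \<open>X\<close> by \<open>f X\<close> in this homomorphism
  property gives \<open>(l\<^sub>Y f - r\<^sub>Y f) l\<^sub>X g = 0\<close> (\<open>anchor_difference_times_left_anchor\<close>). Replacing \<open>X\<close> by
  \<open>f X\<close> in the Jacobi identity itself gives
  \<open>(r\<^sub>Z r\<^sub>Y f - l\<^sub>Y r\<^sub>Z f + r\<^bsub>[Y, Z]\<^esub> f) X = r\<^sub>Z f ([X, Y] + [Y, X]) - (l\<^sub>Y f - r\<^sub>Y f) [X, Z]\<close>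
  (\<open>jacobi_scale_left\<close>), whose part of second order in \<open>f\<close> is \<open>r\<^sub>Z f (l\<^sub>Y f - r\<^sub>Y f) = 0\<close>
  (\<open>right_anchor_times_anchor_difference\<close>). With all sections equal to \<open>X\<close> and all functions equal to
  \<open>f\<close> the two products combine to \<open>(l\<^sub>X f - r\<^sub>X f)\<^sup>2 = 0\<close>, so the anchors agree. Then the left-hand
  side of \<open>jacobi_scale_left\<close> vanishes by the homomorphism property, which leaves
  \<open>l\<^sub>Z f ([X, Y] + [Y, X]) = 0\<close>: wherever some \<open>l\<^sub>Z f\<close> is nonzero the bracket is skew-symmetric.

  All of this is algebra over the ring of smooth functions and is carried out in the locale
  \<open>loday_pseudoalgebra\<close>. The geometric input is a supply of global objects: functions with
  prescribed differential at a point (\<open>smooth_function_with_differential\<close>) and sections with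
  prescribed value at a point (\<open>section_through\<close>), each up to a nonzero factor. Both are obtained by
  cutting off local ones with bump functions, which requires the elementary calculus of smooth
  maps on finite-dimensional inner product spaces.
\<close>

section \<open>The algebra of Loday brackets\<close>

text \<open>The purely algebraic part of a Loday algebroid: \<open>C\<close> and \<open>\<Gamma>\<close> play the roles of the smooth functions
  and of the sections, and \<open>L X\<close>, \<open>R X\<close> those of the derivatives along the images of \<open>X\<close> under the
  two anchors. The only geometry left is that every point carries a nonvanishing section; it is
  what allows a coefficient to be read off from an equation between multiples of a section.\<close>

locale loday_pseudoalgebra =
  fixes C :: "('m \<Rightarrow> real) set" and \<Gamma> :: "('m \<Rightarrow> 'v::real_vector) set"
    and br :: "('m \<Rightarrow> 'v) \<Rightarrow> ('m \<Rightarrow> 'v) \<Rightarrow> 'm \<Rightarrow> 'v"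
    and L R :: "('m \<Rightarrow> 'v) \<Rightarrow> ('m \<Rightarrow> real) \<Rightarrow> 'm \<Rightarrow> real"
  assumes C_mult: "f \<in> C \<Longrightarrow> g \<in> C \<Longrightarrow> (\<lambda>p. f p * g p) \<in> C"
    and \<Gamma>_scale: "f \<in> C \<Longrightarrow> X \<in> \<Gamma> \<Longrightarrow> (\<lambda>p. f p *\<^sub>R X p) \<in> \<Gamma>"
    and br_closed: "X \<in> \<Gamma> \<Longrightarrow> Y \<in> \<Gamma> \<Longrightarrow> br X Y \<in> \<Gamma>"
    and br_diff: "X \<in> \<Gamma> \<Longrightarrow> Y \<in> \<Gamma> \<Longrightarrow> Z \<in> \<Gamma> \<Longrightarrow> br (\<lambda>p. X p - Y p) Z = (\<lambda>p. br X Z p - br Y Z p)"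
      "X \<in> \<Gamma> \<Longrightarrow> Y \<in> \<Gamma> \<Longrightarrow> Z \<in> \<Gamma> \<Longrightarrow> br Z (\<lambda>p. X p - Y p) = (\<lambda>p. br Z X p - br Z Y p)"
    and br_add: "X \<in> \<Gamma> \<Longrightarrow> Y \<in> \<Gamma> \<Longrightarrow> Z \<in> \<Gamma> \<Longrightarrow> br Z (\<lambda>p. X p + Y p) = (\<lambda>p. br Z X p + br Z Y p)"
    and br_scale_right: "g \<in> C \<Longrightarrow> X \<in> \<Gamma> \<Longrightarrow> Y \<in> \<Gamma> \<Longrightarrow>
      br X (\<lambda>p. g p *\<^sub>R Y p) = (\<lambda>p. g p *\<^sub>R br X Y p + L X g p *\<^sub>R Y p)"
    and br_scale_left: "f \<in> C \<Longrightarrow> X \<in> \<Gamma> \<Longrightarrow> Y \<in> \<Gamma> \<Longrightarrow>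
      br (\<lambda>p. f p *\<^sub>R X p) Y = (\<lambda>p. f p *\<^sub>R br X Y p - R Y f p *\<^sub>R X p)"
    and jacobi: "X \<in> \<Gamma> \<Longrightarrow> Y \<in> \<Gamma> \<Longrightarrow> Z \<in> \<Gamma> \<Longrightarrow>
      br X (br Y Z) = (\<lambda>p. br (br X Y) Z p + br Y (br X Z) p)"
    and L_closed: "X \<in> \<Gamma> \<Longrightarrow> g \<in> C \<Longrightarrow> L X g \<in> C"
    and R_closed: "X \<in> \<Gamma> \<Longrightarrow> g \<in> C \<Longrightarrow> R X g \<in> C"
    and L_mult: "f \<in> C \<Longrightarrow> g \<in> C \<Longrightarrow> X \<in> \<Gamma> \<Longrightarrow>
      L X (\<lambda>p. f p * g p) p = f p * L X g p + g p * L X f p"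
    and R_mult: "f \<in> C \<Longrightarrow> g \<in> C \<Longrightarrow> X \<in> \<Gamma> \<Longrightarrow>
      R X (\<lambda>p. f p * g p) p = f p * R X g p + g p * R X f p"
    and L_scale: "f \<in> C \<Longrightarrow> g \<in> C \<Longrightarrow> X \<in> \<Gamma> \<Longrightarrow> L (\<lambda>p. f p *\<^sub>R X p) g p = f p * L X g p"
    and L_diff: "g \<in> C \<Longrightarrow> X \<in> \<Gamma> \<Longrightarrow> Y \<in> \<Gamma> \<Longrightarrow> L (\<lambda>p. X p - Y p) g p = L X g p - L Y g p"
    and L_add: "f \<in> C \<Longrightarrow> g \<in> C \<Longrightarrow> X \<in> \<Gamma> \<Longrightarrow> L X (\<lambda>p. f p + g p) p = L X f p + L X g p"
    and R_add: "f \<in> C \<Longrightarrow> g \<in> C \<Longrightarrow> X \<in> \<Gamma> \<Longrightarrow> R X (\<lambda>p. f p + g p) p = R X f p + R X g p"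
    and nonvanishing: "\<exists>Z\<in>\<Gamma>. Z p \<noteq> 0"
begin

lemmas br_simps = br_diff br_add br_scale_right br_scale_left \<Gamma>_scale br_closed C_mult
  L_closed R_closed

text \<open>Both sides of the Jacobi identity for \<open>X\<close>, \<open>Y\<close>, \<open>h Z\<close> are second order differential operators
  in \<open>h\<close>. The terms with an undifferentiated \<open>h\<close> cancel by the Jacobi identity for \<open>X\<close>, \<open>Y\<close>, \<open>Z\<close>,
  the terms with brackets of \<open>Z\<close> are symmetric in \<open>X\<close> and \<open>Y\<close>, and what remains is a multiple of \<open>Z\<close>.\<close>

lemma left_anchor_hom:
  assumes "X \<in> \<Gamma>" "Y \<in> \<Gamma>" "h \<in> C"
  shows "L (br X Y) h p = L X (L Y h) p - L Y (L X h) p"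
proof -
  obtain Z where Z: "Z \<in> \<Gamma>" "Z p \<noteq> 0" using nonvanishing by blast
  let ?hZ = "\<lambda>q. h q *\<^sub>R Z q"
  have *: "br U (br V ?hZ) p = h p *\<^sub>R br U (br V Z) p + L U h p *\<^sub>R br V Z p
      + L V h p *\<^sub>R br U Z p + L U (L V h) p *\<^sub>R Z p"
    if "U \<in> \<Gamma>" "V \<in> \<Gamma>" for U V
    using that assms(3) Z(1) by (simp add: br_simps)
  have "(L (br X Y) h p - (L X (L Y h) p - L Y (L X h) p)) *\<^sub>R Z p = 0"
    using fun_cong[OF jacobi[OF assms(1,2), of ?hZ], of p]
      fun_cong[OF jacobi[OF assms(1,2) Z(1)], of p]
      *[OF assms(1,2)] *[OF assms(2,1)] assms Z(1)
    by (simp add: br_simps algebra_simps)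
  then show ?thesis using Z(2) by simp
qed

text \<open>The commutator of \<open>L (f X)\<close> with \<open>L Y\<close> differentiates \<open>f\<close> along the left anchor of \<open>Y\<close>, while the
  bracket of \<open>f X\<close> with \<open>Y\<close> differentiates it along the right anchor. As \<open>L\<close> maps the
  bracket to the commutator, it annihilates the difference \<open>(L Y f - R Y f) X\<close>.\<close>

lemma anchor_difference_times_left_anchor:
  assumes "X \<in> \<Gamma>" "Y \<in> \<Gamma>" "f \<in> C" "g \<in> C"
  shows "(L Y f p - R Y f p) * L X g p = 0"
proof -
  let ?fX = "\<lambda>q. f q *\<^sub>R X q"
  have LfX: "L ?fX g = (\<lambda>q. f q * L X g q)" using assms by (auto simp: L_scale)
  have "L (br ?fX Y) g p = f p * L (br X Y) g p - R Y f p * L X g p"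
    using assms by (simp add: br_simps L_diff L_scale)
  moreover have "L (br ?fX Y) g p = f p * L X (L Y g) p - (f p * L Y (L X g) p + L X g p * L Y f p)"
    using assms by (simp add: left_anchor_hom \<Gamma>_scale L_closed L_scale LfX L_mult)
  ultimately show ?thesis using left_anchor_hom[OF assms(1,2,4), of p] by algebra
qed

text \<open>The Jacobi identity for \<open>f X\<close>, \<open>Y\<close>, \<open>Z\<close>, without the terms in which \<open>f\<close> is not differentiated. The term with
  \<open>br X Y + br Y X\<close> is where the failure of skew-symmetry enters: one half comes from
  differentiating \<open>f\<close> inside \<open>br (br (f X) Y) Z\<close>, the other from \<open>br Y (br (f X) Z)\<close>.\<close>

lemma jacobi_scale_left:
  assumes "X \<in> \<Gamma>" "Y \<in> \<Gamma>" "Z \<in> \<Gamma>" "f \<in> C"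
  shows "(R Z (R Y f) p - L Y (R Z f) p + R (br Y Z) f p) *\<^sub>R X p
    = R Z f p *\<^sub>R (br X Y p + br Y X p) - (L Y f p - R Y f p) *\<^sub>R br X Z p"
proof -
  let ?fX = "\<lambda>q. f q *\<^sub>R X q"
  have "br ?fX (br Y Z) p = br (br ?fX Y) Z p + br Y (br ?fX Z) p"
    using jacobi[of ?fX Y Z] assms by (simp add: \<Gamma>_scale)
  moreover have "br ?fX (br Y Z) p = f p *\<^sub>R br X (br Y Z) p - R (br Y Z) f p *\<^sub>R X p"
    using assms by (simp add: br_simps)
  moreover have "br (br ?fX Y) Z p = f p *\<^sub>R br (br X Y) Z p - R Z f p *\<^sub>R br X Y p
      - (R Y f p *\<^sub>R br X Z p - R Z (R Y f) p *\<^sub>R X p)"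
    using assms by (simp add: br_simps)
  moreover have "br Y (br ?fX Z) p = f p *\<^sub>R br Y (br X Z) p + L Y f p *\<^sub>R br X Z p
      - (R Z f p *\<^sub>R br Y X p + L Y (R Z f) p *\<^sub>R X p)"
    using assms by (simp add: br_simps)
  ultimately show ?thesis
    using fun_cong[OF jacobi[OF assms(1-3)], of p] by (simp add: algebra_simps)
qed

text \<open>The principal symbol of the previous identity. Its only terms of second order in \<open>f\<close> are
  \<open>R Z (R Y f) - L Y (R Z f)\<close>; passing from \<open>f\<close> to \<open>f\<^sup>2\<close> and subtracting \<open>2 f\<close> times the original
  identity kills everything of first order and leaves the symbol.\<close>

lemma right_anchor_times_anchor_difference:
  assumes "Y \<in> \<Gamma>" "Z \<in> \<Gamma>" "f \<in> C"
  shows "R Z f p * (L Y f p - R Y f p) = 0"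
proof -
  obtain X where X: "X \<in> \<Gamma>" "X p \<noteq> 0" using nonvanishing by blast
  define D where "D g = R Z (R Y g) p - L Y (R Z g) p + R (br Y Z) g p" for g
  let ?f2 = "\<lambda>q. f q * f q"
  have sq: "R U ?f2 = (\<lambda>q. f q * R U f q + f q * R U f q)"
      "L U ?f2 = (\<lambda>q. f q * L U f q + f q * L U f q)"
    if "U \<in> \<Gamma>" for U
    using assms(3) that by (auto simp: R_mult L_mult)
  have "D ?f2 = 2 * f p * D f - 2 * R Z f p * (L Y f p - R Y f p)"
    unfolding D_def
    by (simp only: sq assms R_mult L_mult R_closed L_closed br_closed C_mult R_add L_add)
       (simp add: algebra_simps)
  moreover
  have "D ?f2 *\<^sub>R X p = (2 * f p) *\<^sub>R (D f *\<^sub>R X p)"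
    unfolding D_def jacobi_scale_left[OF X(1) assms]
      jacobi_scale_left[OF X(1) assms(1,2) C_mult[OF assms(3,3)]]
    using assms by (simp add: sq algebra_simps)
  then have "D ?f2 = 2 * f p * D f" using X(2) by simp
  ultimately show ?thesis by algebra
qed

text \<open>Put \<open>l = L X f p\<close> and \<open>r = R X f p\<close>. The two preceding lemmas say \<open>(l - r) l = 0\<close> and
  \<open>r (l - r) = 0\<close>, so \<open>(l - r)\<^sup>2 = 0\<close>. This works point by point, also on the boundary of the
  set where one of the anchors vanishes.\<close>

lemma left_anchor_eq_right_anchor:
  assumes "X \<in> \<Gamma>" "f \<in> C"
  shows "L X f p = R X f p"
  using anchor_difference_times_left_anchor[OF assms(1,1,2,2), of p]
    right_anchor_times_anchor_difference[OF assms(1,1,2), of p] by auto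

text \<open>For equal anchors the second order terms of the Jacobi identity for \<open>f X\<close>, \<open>Y\<close>, \<open>Z\<close> cancel
  against the anchor of \<open>br Y Z\<close>, and only the symmetric part of the bracket survives.\<close>

lemma skew_symmetric_or_anchor_vanishes:
  assumes "X \<in> \<Gamma>" "Y \<in> \<Gamma>" "Z \<in> \<Gamma>" "f \<in> C"
  shows "L Z f p = 0 \<or> br X Y p = - br Y X p"
proof -
  have RL: "R U g = L U g" if "U \<in> \<Gamma>" "g \<in> C" for U g
    using left_anchor_eq_right_anchor[OF that] by auto
  have "L Z f p *\<^sub>R (br X Y p + br Y X p) = 0"
    using jacobi_scale_left[OF assms, of p] assms
    by (simp add: RL br_closed L_closed left_anchor_hom)
  then show ?thesis by (auto simp: eq_neg_iff_add_eq_0)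
qed

end

section \<open>Calculus of iterated derivatives\<close>

lemma Ck_on_Suc_imp: "Ck_on (Suc k) S f \<Longrightarrow> Ck_on k S f"
proof (induction k arbitrary: f)
  case 0
  then show ?case
    by (auto intro!: continuous_at_imp_continuous_on differentiable_imp_continuous_within)
next
  case (Suc k)
  then show ?case by (metis Ck_on.simps(2))
qed

lemma Ck_on_subset: "Ck_on k S f \<Longrightarrow> T \<subseteq> S \<Longrightarrow> Ck_on k T f"
  by (induction k arbitrary: f) (auto intro: continuous_on_subset)

lemma Ck_on_cong:
  assumes "open S" "Ck_on k S f" "\<And>x. x \<in> S \<Longrightarrow> f x = g x"
  shows "Ck_on k S g"
  using assms(2,3)
proof (induction k arbitrary: f g)
  case 0
  then show ?case using continuous_on_cong[of S S f g] by simp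
next
  case (Suc k)
  have D: "g differentiable (at x)"
      "frechet_derivative f (at x) = frechet_derivative g (at x)" if "x \<in> S" for x
  proof -
    have f: "f differentiable (at x)" using Suc.prems(1) that by simp
    then have "(f has_derivative frechet_derivative f (at x)) (at x)"
      by (simp add: frechet_derivative_works)
    then have g: "(g has_derivative frechet_derivative f (at x)) (at x)"
      by (rule has_derivative_transform_within_open[OF _ \<open>open S\<close> that]) (use Suc.prems in auto)
    then show "g differentiable (at x)" by (auto simp: differentiable_def)
    show "frechet_derivative f (at x) = frechet_derivative g (at x)"
      using g by (rule frechet_derivative_at)
  qed
  have "Ck_on k S (\<lambda>x. frechet_derivative g (at x) v)" for v
    by (rule Suc.IH[of "\<lambda>x. frechet_derivative f (at x) v"]) (use Suc.prems(1) D in auto)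
  then show ?case using D by simp
qed

text \<open>Smoothness on manifolds is checked by covering a chart range with small open sets.\<close>

lemma Ck_on_local:
  assumes "\<And>x. x \<in> S \<Longrightarrow> \<exists>T. open T \<and> x \<in> T \<and> Ck_on k T f"
  shows "Ck_on k S f"
  using assms
proof (induction k arbitrary: f)
  case 0
  then show ?case
    by (metis Ck_on.simps(1) continuous_at_imp_continuous_on continuous_on_eq_continuous_at)
next
  case (Suc k)
  have "f differentiable (at x)" if "x \<in> S" for x using Suc.prems[OF that] by auto
  moreover have "Ck_on k S (\<lambda>x. frechet_derivative f (at x) v)" for v
    by (rule Suc.IH) (use Suc.prems in fastforce)
  ultimately show ?case by simp
qed

text \<open>Induction on the order needs the derivative only up to equality on the open set \<open>S\<close>.\<close>

lemma Ck_on_SucI: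
  assumes "open S" "\<And>x. x \<in> S \<Longrightarrow> (f has_derivative f' x) (at x)"
    and "\<And>v. Ck_on k S (\<lambda>x. f' x v)"
  shows "Ck_on (Suc k) S f"
proof -
  have "Ck_on k S (\<lambda>x. frechet_derivative f (at x) v)" for v
    by (rule Ck_on_cong[OF assms(1) assms(3)[of v]]) (use assms(2) frechet_derivative_at in metis)
  then show ?thesis using assms(2) by (auto simp: differentiable_def)
qed

lemma Ck_on_SucD:
  assumes "Ck_on (Suc k) S f"
  shows "x \<in> S \<Longrightarrow> (f has_derivative frechet_derivative f (at x)) (at x)"
    and "Ck_on k S (\<lambda>x. frechet_derivative f (at x) v)"
  using assms by (auto simp: frechet_derivative_works)

lemma Ck_on_const: "open S \<Longrightarrow> Ck_on k S (\<lambda>x. c)"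
proof (induction k arbitrary: c)
  case (Suc k)
  show ?case by (rule Ck_on_SucI[where f' = "\<lambda>x v. 0"]) (use Suc in auto)
qed simp

lemma Ck_on_ident:
  assumes "open S" shows "Ck_on k S (\<lambda>x. x)"
proof (cases k)
  case (Suc j)
  show ?thesis unfolding Suc
    by (rule Ck_on_SucI[where f' = "\<lambda>x v. v"]) (use assms Ck_on_const in auto)
qed simp

lemma Ck_on_add:
  assumes "open S" "Ck_on k S f" "Ck_on k S g"
  shows "Ck_on k S (\<lambda>x. f x + g x)"
  using assms(2,3)
proof (induction k arbitrary: f g)
  case 0
  then show ?case by (auto intro: continuous_intros)
next
  case (Suc k)
  show ?case
    by (rule Ck_on_SucI[OF assms(1) has_derivative_add[OF Ck_on_SucD(1) Ck_on_SucD(1)]])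
       (use Suc Ck_on_SucD in blast)+
qed

lemma Ck_on_sum:
  assumes "open S" "\<And>i. i \<in> I \<Longrightarrow> Ck_on k S (f i)"
  shows "Ck_on k S (\<lambda>x. \<Sum>i\<in>I. f i x)"
  using assms(2)
proof (induction I rule: infinite_finite_induct)
  case (insert i I)
  then show ?case by (simp add: Ck_on_add[OF assms(1)])
qed (use Ck_on_const[OF assms(1)] in auto)

lemma (in bounded_bilinear) Ck_on_prod:
  assumes "open S" "Ck_on k S f" "Ck_on k S g"
  shows "Ck_on k S (\<lambda>x. prod (f x) (g x))"
  using assms(2,3)
proof (induction k arbitrary: f g)
  case 0
  then show ?case by (auto intro: continuous_on)
next
  case (Suc k)
  show ?case
    by (rule Ck_on_SucI[OF assms(1)
          FDERIV[OF Ck_on_SucD(1)[OF Suc.prems(1)] Ck_on_SucD(1)[OF Suc.prems(2)]]])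
       (auto intro!: Ck_on_add[OF assms(1)] Suc.IH Ck_on_SucD(2) Suc.prems
          intro: Ck_on_Suc_imp simp del: Ck_on.simps)
qed

text \<open>The model spaces are not of class \<^class>\<open>euclidean_space\<close>, so there is no distinguished
  orthonormal basis. An orthogonal spanning family is enough; it may
  contain \<open>0\<close>, whose term in the expansion vanishes.\<close>

lemma dual_basis:
  assumes "finite_dimensional TYPE('a::real_inner)"
  obtains B :: "'a::real_inner set" and u where "finite B" "\<And>w. w = (\<Sum>b\<in>B. (w \<bullet> u b) *\<^sub>R b)"
proof -
  from assms obtain B0 :: "'a set" where "finite B0" "span B0 = UNIV"
    by (auto simp: finite_dimensional_def)
  then obtain B :: "'a set" where B: "finite B" "span B = UNIV" "pairwise orthogonal B"
    using basis_orthogonal[of B0] by metis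
  define u where "u b = (1 / (b \<bullet> b)) *\<^sub>R b" for b :: 'a
  have "w = (\<Sum>b\<in>B. (w \<bullet> u b) *\<^sub>R b)" for w
  proof -
    define d where "d = w - (\<Sum>b\<in>B. (w \<bullet> u b) *\<^sub>R b)"
    have "orthogonal d b" if "b \<in> B" for b
    proof -
      have "(\<Sum>b'\<in>B. (w \<bullet> u b') * (b' \<bullet> b)) = (\<Sum>b'\<in>{b}. (w \<bullet> u b') * (b' \<bullet> b))"
        using B(1,3) that
        by (intro sum.mono_neutral_right) (auto simp: pairwise_def orthogonal_def)
      also have "\<dots> = w \<bullet> b" by (simp add: u_def)
      finally show ?thesis
        by (simp add: d_def orthogonal_def inner_diff_left inner_sum_left)
    qed
    then have "orthogonal d d"
      using orthogonal_to_span[of d B d] B(2) by auto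
    then show ?thesis by (simp add: orthogonal_def d_def)
  qed
  with B(1) show thesis by (rule that)
qed

text \<open>The chain rule has to be iterated: in \<open>Df (g x) (Dg x v)\<close> both the base point and the
  direction depend on \<open>x\<close>. Expanding the direction in a finite basis reduces this to products of
  the functions \<open>x \<mapsto> Df (g x) b\<close>, to which the induction hypothesis applies.\<close>

lemma Ck_on_compose:
  fixes f :: "'b::real_inner \<Rightarrow> 'c::real_normed_vector"
    and g :: "'a::real_normed_vector \<Rightarrow> 'b"
  assumes "finite_dimensional TYPE('b)" "open S" "open T" "g ` S \<subseteq> T"
    and "Ck_on k S g" "Ck_on k T f"
  shows "Ck_on k S (\<lambda>x. f (g x))"
  using assms(5,6)
proof (induction k arbitrary: f)
  case 0
  then show ?case using continuous_on_compose2[of T f S g] assms(4) by auto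
next
  case (Suc k)
  obtain B :: "'b set" and u where B: "finite B" "\<And>w. w = (\<Sum>b\<in>B. (w \<bullet> u b) *\<^sub>R b)"
    using dual_basis[OF assms(1)] by metis
  define Df where "Df y = frechet_derivative f (at y)" for y
  define Dg where "Dg x = frechet_derivative g (at x)" for x
  define D where "D x v = (\<Sum>b\<in>B. (Dg x v \<bullet> u b) *\<^sub>R Df (g x) b)" for x v
  have "((\<lambda>x. f (g x)) has_derivative D x) (at x)" if "x \<in> S" for x
  proof -
    have f: "(f has_derivative Df (g x)) (at (g x))"
      using Ck_on_SucD(1)[OF Suc.prems(2)] that assms(4) by (auto simp: Df_def)
    then have lin: "linear (Df (g x))" by (rule has_derivative_linear)
    have Df_expand: "Df (g x) w = (\<Sum>b\<in>B. (w \<bullet> u b) *\<^sub>R Df (g x) b)" for w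
    proof -
      have "Df (g x) w = Df (g x) (\<Sum>b\<in>B. (w \<bullet> u b) *\<^sub>R b)"
        by (rule arg_cong[OF B(2)])
      then show ?thesis by (simp add: linear_sum[OF lin] linear_cmul[OF lin])
    qed
    have "D x = (\<lambda>v. Df (g x) (Dg x v))"
      unfolding D_def by (intro ext Df_expand[symmetric])
    then show ?thesis
      using has_derivative_compose[OF Ck_on_SucD(1)[OF Suc.prems(1) that] f]
      by (simp add: Dg_def)
  qed
  moreover have "Ck_on k S (\<lambda>x. D x v)" for v
    unfolding D_def
  proof (rule Ck_on_sum[OF assms(2)])
    fix b
    have "Ck_on k S (\<lambda>x. Df (g x) b)"
      by (rule Suc.IH[of "\<lambda>y. Df y b"])
         (use Suc.prems Ck_on_Suc_imp in \<open>auto simp: Df_def\<close>)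
    moreover have "Ck_on k S (\<lambda>x. Dg x v \<bullet> u b)"
      unfolding Dg_def
      by (rule bounded_bilinear.Ck_on_prod[OF bounded_bilinear_inner assms(2)
            Ck_on_SucD(2)[OF Suc.prems(1)] Ck_on_const[OF assms(2)]])
    ultimately show "Ck_on k S (\<lambda>x. (Dg x v \<bullet> u b) *\<^sub>R Df (g x) b)"
      by (intro bounded_bilinear.Ck_on_prod[OF bounded_bilinear_scaleR assms(2)])
  qed
  ultimately show ?case by (rule Ck_on_SucI[OF assms(2)])
qed

lemma finite_dimensional_real: "finite_dimensional TYPE(real)"
  unfolding finite_dimensional_def
proof (intro exI conjI)
  show "span {1::real} = UNIV" by (auto simp: span_singleton)
qed simp

text \<open>The ball is a closed subset of the image of a box of coordinates under a continuous map.
  Compactness of small balls is what makes supports of bump functions closed in the whole manifold.\<close>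

lemma compact_cball_finite_dimensional:
  fixes c :: "'a::real_inner"
  assumes "finite_dimensional TYPE('a)"
  shows "compact (cball c r)"
proof -
  obtain B :: "'a set" and u where B: "finite B" "\<And>w. w = (\<Sum>b\<in>B. (w \<bullet> u b) *\<^sub>R b)"
    using dual_basis[OF assms] by metis
  define m where "m b = (norm c + r) * norm (u b)" for b
  have "\<exists>K. compact K \<and> (\<forall>s. (\<forall>b\<in>B. \<bar>s b\<bar> \<le> m b) \<longrightarrow> (\<Sum>b\<in>B. s b *\<^sub>R b) \<in> K)"
    using B(1)
  proof (induction B rule: finite_induct)
    case empty
    show ?case by (rule exI[of _ "{0}"]) auto
  next
    case (insert b B)
    then obtain K where K: "compact K"
      "\<And>s. (\<forall>b\<in>B. \<bar>s b\<bar> \<le> m b) \<Longrightarrow> (\<Sum>b\<in>B. s b *\<^sub>R b) \<in> K" by metis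
    let ?K = "(\<lambda>z. fst z *\<^sub>R b + snd z) ` ({- m b..m b} \<times> K)"
    have "compact ?K"
      by (intro compact_continuous_image compact_Times K continuous_intros compact_Icc)
    moreover have "(\<Sum>b\<in>insert b B. s b *\<^sub>R b) \<in> ?K" if "\<forall>b\<in>insert b B. \<bar>s b\<bar> \<le> m b" for s
    proof (rule image_eqI)
      show "(s b, \<Sum>b\<in>B. s b *\<^sub>R b) \<in> {- m b..m b} \<times> K" using that K(2)[of s] by auto
    qed (use insert in simp)
    ultimately show ?case by blast
  qed
  then obtain K where K: "compact K"
    "\<And>s. (\<forall>b\<in>B. \<bar>s b\<bar> \<le> m b) \<Longrightarrow> (\<Sum>b\<in>B. s b *\<^sub>R b) \<in> K" by metis
  have "w \<in> K" if "w \<in> cball c r" for w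
  proof -
    have "norm w \<le> norm c + r"
      using that norm_triangle_ineq[of c "w - c"] by (simp add: dist_norm norm_minus_commute)
    then have "\<bar>w \<bullet> u b\<bar> \<le> m b" for b
      using Cauchy_Schwarz_ineq2[of w "u b"] mult_right_mono[of "norm w" "norm c + r" "norm (u b)"]
      by (simp add: m_def)
    then have "(\<Sum>b\<in>B. (w \<bullet> u b) *\<^sub>R b) \<in> K" by (intro K(2)) auto
    then show ?thesis by (subst B(2))
  qed
  then have "K \<inter> cball c r = cball c r" by blast
  then show ?thesis using compact_Int_closed[OF K(1) closed_cball[of c r]] by simp
qed

lemma Ck_on_inverse:
  assumes "open S" "0 \<notin> S"
  shows "Ck_on k S (inverse :: real \<Rightarrow> real)"
proof (induction k)
  case 0
  then show ?case using assms by (auto intro!: continuous_intros)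
next
  case (Suc k)
  show ?case
  proof (rule Ck_on_SucI[OF assms(1)])
    show "(inverse has_derivative (\<lambda>v. - (inverse x * v * inverse x))) (at x)"
      if "x \<in> S" for x :: real
      using that assms(2) by (auto intro!: has_derivative_inverse')
    have "Ck_on k S (\<lambda>x. inverse x * (inverse x * (- v)))" for v
      by (intro bounded_bilinear.Ck_on_prod[OF bounded_bilinear_mult assms(1)] Suc
          Ck_on_const assms(1))
    then show "Ck_on k S (\<lambda>x. - (inverse x * v * inverse x))" for v
      by (simp add: mult_ac)
  qed
qed

text \<open>The usual flat function is \<open>exp_inv 0\<close>. The additional power of \<open>1 / t\<close> makes the family closed
  under differentiation, so that one induction gives all derivatives.\<close>

definition exp_inv :: "nat \<Rightarrow> real \<Rightarrow> real" where
  "exp_inv n t = (if t > 0 then inverse t ^ n * exp (- inverse t) else 0)"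

lemma exp_inv_tendsto_0: "(exp_inv n \<longlongrightarrow> 0) (at 0)"
proof -
  have "((\<lambda>t. inverse t ^ n / exp (inverse t)) \<longlongrightarrow> (0::real)) (at_right 0)"
    by (rule filterlim_compose[OF tendsto_power_div_exp_0 filterlim_inverse_at_top_right])
  then have "(exp_inv n \<longlongrightarrow> 0) (at_right 0)"
    by (rule Lim_transform_eventually)
       (auto simp: exp_inv_def exp_minus field_simps eventually_at_filter)
  moreover have "(exp_inv n \<longlongrightarrow> 0) (at_left 0)"
    by (rule Lim_transform_eventually[OF tendsto_const])
       (auto simp: exp_inv_def eventually_at_filter)
  ultimately show ?thesis by (simp add: filterlim_at_split)
qed

lemma exp_inv_has_derivative:
  "(exp_inv n has_field_derivative (exp_inv (n + 2) t - n * exp_inv (n + 1) t)) (at t)"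
proof (cases t "0 :: real" rule: linorder_cases)
  case less
  have "((\<lambda>t. 0) has_field_derivative 0) (at t)" by simp
  then have "(exp_inv n has_field_derivative 0) (at t)"
    by (rule has_field_derivative_transform_within_open[where S = "{..<0}"])
       (use less in \<open>auto simp: exp_inv_def\<close>)
  then show ?thesis using less by (simp add: exp_inv_def)
next
  case equal
  have "(\<lambda>s. (exp_inv n (0 + s) - exp_inv n 0) / s) = exp_inv (n + 1)"
    by (simp add: fun_eq_iff exp_inv_def divide_simps)
  then have "(exp_inv n has_field_derivative 0) (at 0)"
    using exp_inv_tendsto_0[of "n + 1"] by (simp only: DERIV_def)
  then show ?thesis using equal by (simp add: exp_inv_def)
next
  case greater
  have "((\<lambda>t. inverse t ^ n * exp (- inverse t)) has_field_derivative
      (exp_inv (n + 2) t - n * exp_inv (n + 1) t)) (at t)"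
    using greater
    by (auto intro!: derivative_eq_intros simp: exp_inv_def field_simps power2_eq_square)
       (cases n; simp add: field_simps)
  then show ?thesis
    by (rule has_field_derivative_transform_within_open[where S = "{0<..}"])
       (use greater in \<open>auto simp: exp_inv_def\<close>)
qed

lemma Ck_on_exp_inv: "Ck_on k UNIV (exp_inv n)"
proof (induction k arbitrary: n)
  case 0
  then show ?case
    using DERIV_isCont[OF exp_inv_has_derivative] by (simp add: continuous_at_imp_continuous_on)
next
  case (Suc k)
  have "Ck_on k UNIV (\<lambda>x. (exp_inv (n + 2) x + (- real n) * exp_inv (n + 1) x) * v)" for v
    by (intro bounded_bilinear.Ck_on_prod[OF bounded_bilinear_mult] Ck_on_add Suc
        Ck_on_const open_UNIV)
  then show ?case
    using exp_inv_has_derivative[of n]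
    by (intro Ck_on_SucI[where f' = "\<lambda>t v. (exp_inv (n + 2) t - n * exp_inv (n + 1) t) * v"])
       (auto simp: has_field_derivative_def)
qed

lemma smooth_on_compose:
  fixes f :: "'b::real_inner \<Rightarrow> 'c::real_normed_vector"
  assumes "finite_dimensional TYPE('b)" "open S" "open T" "g ` S \<subseteq> T"
    and "smooth_on S g" "smooth_on T f"
  shows "smooth_on S (\<lambda>x. f (g x))"
  using assms(5,6) unfolding smooth_on_def by (blast intro: Ck_on_compose[OF assms(1-4), of _ f])

lemma smooth_on_bump:
  fixes c :: "'a::real_inner"
  assumes "r > 0"
  obtains b :: "'a \<Rightarrow> real"
  where "smooth_on UNIV b" "b c \<noteq> 0" "\<And>x. x \<notin> cball c r \<Longrightarrow> b x = 0"
proof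
  let ?g = "\<lambda>x. r\<^sup>2 + (-1) * ((x + (- c)) \<bullet> (x + (- c)))"
  let ?b = "\<lambda>x. exp_inv 0 (?g x)"
  show "smooth_on UNIV ?b"
  proof (rule smooth_on_compose[OF finite_dimensional_real open_UNIV open_UNIV,
        of ?g "exp_inv 0"])
    show "smooth_on UNIV (exp_inv 0)" using Ck_on_exp_inv by (simp add: smooth_on_def)
    show "smooth_on UNIV ?g"
      unfolding smooth_on_def
      by (intro allI Ck_on_add Ck_on_const Ck_on_ident open_UNIV
          bounded_bilinear.Ck_on_prod[OF bounded_bilinear_mult]
          bounded_bilinear.Ck_on_prod[OF bounded_bilinear_inner])
  qed simp
  show "?b c \<noteq> 0" using assms by (simp add: exp_inv_def)
  show "?b x = 0" if "x \<notin> cball c r" for x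
  proof -
    have "r < norm (x - c)" using that by (simp add: dist_norm norm_minus_commute)
    then have "r\<^sup>2 < (norm (x - c))\<^sup>2" using assms by (intro power_strict_mono) auto
    then show ?thesis by (simp add: exp_inv_def dot_square_norm)
  qed
qed

section \<open>Smooth functions on manifolds\<close>

lemma smooth_manifoldD:
  assumes "smooth_manifold (A :: ('m::{t2_space, second_countable_topology}, 'e::real_inner) chart set)"
  shows finite_dimensional_model: "finite_dimensional TYPE('e)"
    and open_chart_domain: "(U, \<phi>) \<in> A \<Longrightarrow> open U"
    and open_chart_range: "(U, \<phi>) \<in> A \<Longrightarrow> open (\<phi> ` U)"
    and chart_homeomorphism: "(U, \<phi>) \<in> A \<Longrightarrow> homeomorphism U (\<phi> ` U) \<phi> (inv_into U \<phi>)"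
    and charts_cover: "\<exists>U \<phi>. (U, \<phi>) \<in> A \<and> p \<in> U"
    and smooth_transition:
      "(U, \<phi>) \<in> A \<Longrightarrow> (V, \<psi>) \<in> A \<Longrightarrow> smooth_on (\<phi> ` (U \<inter> V)) (\<psi> \<circ> inv_into U \<phi>)"
  using assms unfolding smooth_manifold_def by blast+

lemma smooth_map_onD: "smooth_map_on A W f \<Longrightarrow> (U, \<phi>) \<in> A \<Longrightarrow>
    smooth_on (\<phi> ` (U \<inter> W)) (f \<circ> inv_into U \<phi>)"
  unfolding smooth_map_on_def by blast

lemma smooth_map_on_subset: "smooth_map_on A W f \<Longrightarrow> V \<subseteq> W \<Longrightarrow> smooth_map_on A V f"
  unfolding smooth_map_on_def smooth_on_def
  by (blast intro: Ck_on_subset[OF _ image_mono])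

lemma smooth_map_on_smooth_function: "f \<in> smooth_functions A \<Longrightarrow> smooth_map_on A W f"
  unfolding smooth_functions_def by (blast intro: smooth_map_on_subset)

context
  fixes A :: "('m::{t2_space, second_countable_topology}, 'e::real_inner) chart set"
  assumes manifold: "smooth_manifold A"
begin

lemma inv_chart [simp]: "(U, \<phi>) \<in> A \<Longrightarrow> q \<in> U \<Longrightarrow> inv_into U \<phi> (\<phi> q) = q"
  using chart_homeomorphism[OF manifold] by (metis homeomorphism_apply1)

lemma open_chart_image:
  assumes "(U, \<phi>) \<in> A" "open W"
  shows "open (\<phi> ` (U \<inter> W))"
proof -
  have "openin (top_of_set (\<phi> ` U)) (\<phi> ` (U \<inter> W))"
    using homeomorphism_imp_open_map[OF chart_homeomorphism[OF manifold assms(1)]] assms(2)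
    by (simp add: openin_open_Int)
  then show ?thesis using openin_open_trans open_chart_range[OF manifold assms(1)] by blast
qed

lemma smooth_map_on_local:
  assumes "open W"
    and "\<And>q. q \<in> W \<Longrightarrow>
      \<exists>N g. open N \<and> q \<in> N \<and> N \<subseteq> W \<and> smooth_map_on A N g \<and> (\<forall>r\<in>N. g r = f r)"
  shows "smooth_map_on A W f"
  unfolding smooth_map_on_def smooth_on_def
proof (clarify, rule Ck_on_local)
  fix U \<phi> k x
  assume U: "(U, \<phi>) \<in> A" and "x \<in> \<phi> ` (U \<inter> W)"
  then obtain q where q: "q \<in> U" "q \<in> W" "x = \<phi> q" by auto
  then obtain N g where N: "open N" "q \<in> N" "N \<subseteq> W" "smooth_map_on A N g" "\<forall>r\<in>N. g r = f r"
    using assms(2) by blast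
  have o: "open (\<phi> ` (U \<inter> N))" by (rule open_chart_image[OF U N(1)])
  have "Ck_on k (\<phi> ` (U \<inter> N)) (g \<circ> inv_into U \<phi>)"
    using smooth_map_onD[OF N(4) U] by (simp add: smooth_on_def)
  then have "Ck_on k (\<phi> ` (U \<inter> N)) (f \<circ> inv_into U \<phi>)"
    by (rule Ck_on_cong[OF o]) (use N(5) U in auto)
  then show "\<exists>T. open T \<and> x \<in> T \<and> Ck_on k T (f \<circ> inv_into U \<phi>)"
    using o q N(2) by blast
qed

lemma smooth_map_on_cong:
  "open W \<Longrightarrow> smooth_map_on A W g \<Longrightarrow> (\<And>r. r \<in> W \<Longrightarrow> g r = f r) \<Longrightarrow> smooth_map_on A W f"
  by (rule smooth_map_on_local) blast+

lemma smooth_map_on_const: "open W \<Longrightarrow> smooth_map_on A W (\<lambda>p. c)"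
  unfolding smooth_map_on_def smooth_on_def comp_def
  by (blast intro: Ck_on_const open_chart_image)

lemma smooth_map_on_add:
  "open W \<Longrightarrow> smooth_map_on A W f \<Longrightarrow> smooth_map_on A W g \<Longrightarrow> smooth_map_on A W (\<lambda>p. f p + g p)"
  unfolding smooth_map_on_def smooth_on_def comp_def
  by (clarify, intro Ck_on_add open_chart_image) fastforce+

lemma smooth_map_on_bilinear:
  "bounded_bilinear b \<Longrightarrow> open W \<Longrightarrow> smooth_map_on A W f \<Longrightarrow> smooth_map_on A W g \<Longrightarrow>
    smooth_map_on A W (\<lambda>p. b (f p) (g p))"
  unfolding smooth_map_on_def smooth_on_def comp_def
  by (clarify, intro bounded_bilinear.Ck_on_prod[of b] open_chart_image) fastforce+

lemma smooth_map_on_compose: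
  fixes g :: "'m \<Rightarrow> 'b::real_inner" and f :: "'b \<Rightarrow> 'c::real_normed_vector"
  assumes "finite_dimensional TYPE('b)" "open W" "open T" "g ` W \<subseteq> T"
    and "smooth_map_on A W g" "smooth_on T f"
  shows "smooth_map_on A W (\<lambda>p. f (g p))"
  unfolding smooth_map_on_def
proof clarify
  fix U \<phi> assume U: "(U, \<phi>) \<in> A"
  show "smooth_on (\<phi> ` (U \<inter> W)) ((\<lambda>p. f (g p)) \<circ> inv_into U \<phi>)"
    unfolding comp_def
    by (rule smooth_on_compose[OF assms(1) open_chart_image[OF U assms(2)] assms(3) _
          smooth_map_onD[OF assms(5) U, unfolded comp_def] assms(6)])
       (use assms(4) U in auto)
qed

lemma smooth_map_on_chart: "(U, \<phi>) \<in> A \<Longrightarrow> smooth_map_on A U \<phi>"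
  unfolding smooth_map_on_def using smooth_transition[OF manifold] by auto

text \<open>Extension by zero: \<open>f\<close> has to be examined only on \<open>N\<close>, because it vanishes off the closed set
  \<open>C \<subseteq> N\<close>.\<close>

lemma smooth_map_on_extend_zero:
  assumes "open W" "open N" "closed C" "C \<subseteq> N" "smooth_map_on A (W \<inter> N) f"
    and "\<And>q. q \<in> W - C \<Longrightarrow> f q = 0"
  shows "smooth_map_on A W f"
proof (rule smooth_map_on_local[OF assms(1)])
  fix q assume q: "q \<in> W"
  show "\<exists>N g. open N \<and> q \<in> N \<and> N \<subseteq> W \<and> smooth_map_on A N g \<and> (\<forall>r\<in>N. g r = f r)"
  proof (cases "q \<in> C")
    case True
    then show ?thesis
      using q assms(1,2,4,5) by (intro exI[of _ "W \<inter> N"] exI[of _ f]) auto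
  next
    case False
    have "open (W - C)" using assms(1,3) by (rule open_Diff)
    then show ?thesis
      using q False assms(6) smooth_map_on_const[of "W - C" 0]
      by (intro exI[of _ "W - C"] exI[of _ "\<lambda>p. 0"]) auto
  qed
qed

text \<open>A bump in a chart is transported to the manifold. Its support is the preimage of a closed ball,
  hence compact, hence closed because the manifold is Hausdorff.\<close>

lemma smooth_functions_bump:
  assumes "open W" "p \<in> W"
  obtains \<rho> C where "\<rho> \<in> smooth_functions A" "\<rho> p \<noteq> 0" "closed C" "C \<subseteq> W"
    "\<And>q. q \<notin> C \<Longrightarrow> \<rho> q = 0"
proof -
  obtain U \<phi> where U: "(U, \<phi>) \<in> A" "p \<in> U" using charts_cover[OF manifold] by blast
  have "open (\<phi> ` (U \<inter> W))" by (rule open_chart_image[OF U(1) assms(1)])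
  moreover have "\<phi> p \<in> \<phi> ` (U \<inter> W)" using U(2) assms(2) by blast
  ultimately obtain r where r: "r > 0" "cball (\<phi> p) r \<subseteq> \<phi> ` (U \<inter> W)"
    unfolding open_contains_cball by blast
  obtain b :: "'e \<Rightarrow> real" where b: "smooth_on UNIV b" "b (\<phi> p) \<noteq> 0" "\<And>x. x \<notin> cball (\<phi> p) r \<Longrightarrow> b x = 0"
    using smooth_on_bump[OF r(1)] by metis
  define C where "C = inv_into U \<phi> ` cball (\<phi> p) r"
  define \<rho> where "\<rho> q = (if q \<in> U then b (\<phi> q) else 0)" for q
  have "compact C"
    unfolding C_def
  proof (rule compact_continuous_image)
    show "continuous_on (cball (\<phi> p) r) (inv_into U \<phi>)"
      using chart_homeomorphism[OF manifold U(1)] r(2)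
      by (auto simp: homeomorphism_def intro: continuous_on_subset)
    show "compact (cball (\<phi> p) r)"
      by (rule compact_cball_finite_dimensional[OF finite_dimensional_model[OF manifold]])
  qed
  then have "closed C" by (rule compact_imp_closed)
  have C: "C \<subseteq> U \<inter> W"
  proof
    fix q assume "q \<in> C"
    then obtain x where x: "x \<in> cball (\<phi> p) r" "q = inv_into U \<phi> x" by (auto simp: C_def)
    then obtain q' where "q' \<in> U \<inter> W" "x = \<phi> q'" using r(2) by blast
    then show "q \<in> U \<inter> W" using x U by auto
  qed
  have zero: "\<rho> q = 0" if "q \<notin> C" for q
  proof (cases "q \<in> U")
    case True
    have "\<phi> q \<notin> cball (\<phi> p) r"
      using that U(1) True unfolding C_def by (metis image_eqI inv_chart)
    then show ?thesis using b(3) by (simp add: \<rho>_def)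
  qed (simp add: \<rho>_def)
  have oU: "open U" by (rule open_chart_domain[OF manifold U(1)])
  have "smooth_map_on A U (\<lambda>q. b (\<phi> q))"
    by (rule smooth_map_on_compose[OF finite_dimensional_model[OF manifold] oU open_UNIV _
          smooth_map_on_chart[OF U(1)] b(1)]) simp
  then have "smooth_map_on A U \<rho>"
    by (rule smooth_map_on_cong[OF oU]) (simp add: \<rho>_def)
  then have "smooth_map_on A UNIV \<rho>"
    by (intro smooth_map_on_extend_zero[OF open_UNIV oU \<open>closed C\<close>]) (use C zero in auto)
  then show thesis
    using that[of \<rho> C] b(2) U(2) C zero \<open>closed C\<close>
    by (auto simp: smooth_functions_def \<rho>_def)
qed

lemma smooth_functions_continuous:
  assumes "f \<in> smooth_functions A"
  shows "continuous_on UNIV f"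
proof -
  have "isCont f q" for q
  proof -
    obtain U \<phi> where U: "(U, \<phi>) \<in> A" "q \<in> U" using charts_cover[OF manifold] by blast
    have "Ck_on 0 (\<phi> ` (U \<inter> UNIV)) (f \<circ> inv_into U \<phi>)"
      using assms smooth_map_onD[OF _ U(1)] unfolding smooth_functions_def smooth_on_def by blast
    then have "continuous_on (\<phi> ` U) (f \<circ> inv_into U \<phi>)" by simp
    with homeomorphism_cont1[OF chart_homeomorphism[OF manifold U(1)]]
    have "continuous_on U ((f \<circ> inv_into U \<phi>) \<circ> \<phi>)"
      by (rule continuous_on_compose)
    then have "continuous_on U f"
      by (rule continuous_on_eq) (simp add: inv_chart[OF U(1)])
    then show ?thesis
      using open_chart_domain[OF manifold U(1)] U(2) continuous_on_eq_continuous_at by blast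
  qed
  then show ?thesis by (simp add: continuous_at_imp_continuous_on)
qed

lemma smooth_functions_const: "(\<lambda>p. c) \<in> smooth_functions A"
  by (simp add: smooth_functions_def smooth_map_on_const)

lemma smooth_functions_mult:
  "f \<in> smooth_functions A \<Longrightarrow> g \<in> smooth_functions A \<Longrightarrow> (\<lambda>p. f p * g p) \<in> smooth_functions A"
  by (simp add: smooth_functions_def smooth_map_on_bilinear[OF bounded_bilinear_mult])

section \<open>Tangent maps of smooth functions\<close>

lemma chart_at_cases:
  obtains U \<phi> where "chart_at A p = (U, \<phi>)" "(U, \<phi>) \<in> A" "p \<in> U"
proof -
  obtain U \<phi> where "(U, \<phi>) \<in> A" "p \<in> U" using charts_cover[OF manifold] by blast
  then have "(U, \<phi>) \<in> A \<and> p \<in> fst (U, \<phi>)" by simp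
  then have "chart_at A p \<in> A \<and> p \<in> fst (chart_at A p)"
    unfolding chart_at_def by (rule someI)
  then show thesis using that by (metis prod.collapse)
qed

lemma has_derivative_tangent_map:
  assumes "f \<in> smooth_functions A" "chart_at A p = (U, \<phi>)"
  shows "((\<lambda>x. f (inv_into U \<phi> x)) has_derivative tangent_map A p f) (at (\<phi> p))"
proof -
  have U: "(U, \<phi>) \<in> A" "p \<in> U" using chart_at_cases[of p] assms(2) by auto
  have "Ck_on (Suc 0) (\<phi> ` (U \<inter> UNIV)) (f \<circ> inv_into U \<phi>)"
    using assms smooth_map_onD[OF _ U(1)] unfolding smooth_functions_def smooth_on_def by blast
  from Ck_on_SucD(1)[OF this, of "\<phi> p"] show ?thesis
    using U(2) assms(2) by (simp add: tangent_map_def comp_def)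
qed

lemma tangent_mapI:
  assumes "chart_at A p = (U, \<phi>)" "((\<lambda>x. f (inv_into U \<phi> x)) has_derivative D) (at (\<phi> p))"
  shows "tangent_map A p f = D"
  using frechet_derivative_at[OF assms(2)] assms(1) by (simp add: tangent_map_def comp_def)

lemma tangent_map_linear:
  "f \<in> smooth_functions A \<Longrightarrow> linear (tangent_map A p f)"
  using chart_at_cases[of p] has_derivative_tangent_map[of f p] has_derivative_linear by metis

lemma tangent_map_const: "tangent_map A p (\<lambda>q. c) = (\<lambda>v. 0)"
  by (rule chart_at_cases[of p], rule tangent_mapI, assumption) simp

lemma tangent_map_add:
  assumes "f \<in> smooth_functions A" "g \<in> smooth_functions A"
  shows "tangent_map A p (\<lambda>q. f q + g q) = (\<lambda>v. tangent_map A p f v + tangent_map A p g v)"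
proof -
  obtain U \<phi> where U: "chart_at A p = (U, \<phi>)" by (rule chart_at_cases)
  show ?thesis
    by (rule tangent_mapI[OF U has_derivative_add[OF has_derivative_tangent_map[OF assms(1) U]
            has_derivative_tangent_map[OF assms(2) U]]])
qed

lemma tangent_map_mult:
  assumes "f \<in> smooth_functions A" "g \<in> smooth_functions A"
  shows "tangent_map A p (\<lambda>q. f q * g q) =
    (\<lambda>v. f p * tangent_map A p g v + g p * tangent_map A p f v)"
proof -
  obtain U \<phi> where U: "chart_at A p = (U, \<phi>)" "(U, \<phi>) \<in> A" "p \<in> U" by (rule chart_at_cases)
  show ?thesis
    using tangent_mapI[OF U(1) has_derivative_mult[OF has_derivative_tangent_map[OF assms(1) U(1)]
          has_derivative_tangent_map[OF assms(2) U(1)]]] inv_chart[OF U(2,3)]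
    by (simp add: mult.commute)
qed

text \<open>Every covector at \<open>p\<close> is, up to a nonzero factor, the differential of a global function: the
  corresponding affine coordinate that vanishes at \<open>p\<close>, cut off by a bump \<open>\<rho>\<close>. As the
  coordinate vanishes at \<open>p\<close>, the derivative of \<open>\<rho>\<close> there does not contribute.\<close>

lemma smooth_function_with_differential:
  obtains g c where "g \<in> smooth_functions A" "c \<noteq> 0" "\<And>u. tangent_map A p g u = c * (u \<bullet> w)"
proof -
  obtain U \<phi> where U: "chart_at A p = (U, \<phi>)" "(U, \<phi>) \<in> A" "p \<in> U" by (rule chart_at_cases)
  have oU: "open U" by (rule open_chart_domain[OF manifold U(2)])
  obtain \<rho> C where \<rho>: "\<rho> \<in> smooth_functions A" "\<rho> p \<noteq> 0" "closed C" "C \<subseteq> U"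
      "\<And>q. q \<notin> C \<Longrightarrow> \<rho> q = 0"
    by (rule smooth_functions_bump[OF oU U(3)]) blast
  define g where "g q = \<rho> q * ((\<phi> q + - \<phi> p) \<bullet> w)" for q
  have "smooth_map_on A U g"
    unfolding g_def
    by (intro smooth_map_on_bilinear[OF bounded_bilinear_mult oU]
        smooth_map_on_bilinear[OF bounded_bilinear_inner oU]
        smooth_map_on_add[OF oU] smooth_map_on_const[OF oU]
        smooth_map_on_chart[OF U(2)])
      (rule smooth_map_on_smooth_function[OF \<rho>(1)])
  then have "smooth_map_on A UNIV g"
    by (intro smooth_map_on_extend_zero[OF open_UNIV oU \<rho>(3,4)])
       (auto simp: g_def \<rho>(5))
  then have g: "g \<in> smooth_functions A" by (simp add: smooth_functions_def)
  have "((\<lambda>x. \<rho> (inv_into U \<phi> x) * ((x + - \<phi> p) \<bullet> w)) has_derivative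
      (\<lambda>u. \<rho> p * (u \<bullet> w))) (at (\<phi> p))"
    by (rule has_derivative_eq_rhs[OF has_derivative_mult[OF
          has_derivative_tangent_map[OF \<rho>(1) U(1)]]])
       (auto intro!: derivative_eq_intros simp: inv_chart[OF U(2,3)])
  then have "((\<lambda>x. g (inv_into U \<phi> x)) has_derivative (\<lambda>u. \<rho> p * (u \<bullet> w))) (at (\<phi> p))"
    by (rule has_derivative_transform_within_open[OF _ open_chart_range[OF manifold U(2)]])
       (use U in \<open>auto simp: g_def inv_chart[OF U(2)]\<close>)
  then have "tangent_map A p g u = \<rho> p * (u \<bullet> w)" for u using tangent_mapI[OF U(1)] by metis
  with g \<rho>(2) show thesis by (rule that)
qed

end

section \<open>Sections of vector bundles\<close>

lemma linear_betweenD: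
  assumes "linear_between V W h"
  shows "u \<in> V \<Longrightarrow> h u \<in> W" "u \<in> V \<Longrightarrow> v \<in> V \<Longrightarrow> h (u + v) = h u + h v"
    "v \<in> V \<Longrightarrow> h (c *\<^sub>R v) = c *\<^sub>R h v"
  using assms by (auto simp: linear_between_def)

lemma linear_between_diff:
  assumes "linear_between V W h" "subspace V" "u \<in> V" "v \<in> V"
  shows "h (u - v) = h u - h v"
  using linear_betweenD(2)[OF assms(1,3), of "(-1) *\<^sub>R v"] linear_betweenD(3)[OF assms(1,4), of "-1"]
    subspace_scale[OF assms(2,4), of "-1"] by simp

lemma linear_between_zero: "linear_between V W h \<Longrightarrow> subspace V \<Longrightarrow> h 0 = 0"
  using linear_betweenD(3)[of V W h 0 0] subspace_0 by auto

context
  fixes A :: "('m::{t2_space, second_countable_topology}, 'e::real_inner) chart set"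
    and E :: "('m, 'v::real_vector, 'f::real_inner) vbundle"
  assumes manifold: "smooth_manifold A" and vec_bundle: "vector_bundle A E"
begin

lemma subspace_fibre: "subspace (fibre E p)"
  using vec_bundle by (simp add: vector_bundle_def)

lemma trivializationD:
  assumes "(W, \<Phi>) \<in> trivializations E"
  shows "open W" and "p \<in> W \<Longrightarrow> linear_between (fibre E p) UNIV (\<Phi> p)"
    and "p \<in> W \<Longrightarrow> bij_betw (\<Phi> p) (fibre E p) UNIV"
    and "(W', \<Psi>) \<in> trivializations E \<Longrightarrow>
      smooth_map_on A (W \<inter> W') (\<lambda>p. \<Psi> p (inv_into (fibre E p) (\<Phi> p) v))"
  using assms vec_bundle unfolding vector_bundle_def by blast+

lemma trivializations_cover: "\<exists>W \<Phi>. (W, \<Phi>) \<in> trivializations E \<and> p \<in> W"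
  using vec_bundle unfolding vector_bundle_def by blast

lemma sectionD:
  assumes "X \<in> sections A E"
  shows "X p \<in> fibre E p"
    and "(W, \<Phi>) \<in> trivializations E \<Longrightarrow> smooth_map_on A W (\<lambda>p. \<Phi> p (X p))"
  using assms unfolding sections_def by blast+

lemma sectionI:
  assumes "\<And>p. X p \<in> fibre E p"
    and "\<And>W \<Phi>. (W, \<Phi>) \<in> trivializations E \<Longrightarrow> smooth_map_on A W (\<lambda>p. \<Phi> p (X p))"
  shows "X \<in> sections A E"
  using assms unfolding sections_def by blast

lemma sections_scale:
  assumes "f \<in> smooth_functions A" "X \<in> sections A E"
  shows "(\<lambda>p. f p *\<^sub>R X p) \<in> sections A E"
proof (rule sectionI)
  show "f p *\<^sub>R X p \<in> fibre E p" for p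
    by (intro subspace_scale subspace_fibre sectionD(1) assms)
  fix W \<Phi> assume W: "(W, \<Phi>) \<in> trivializations E"
  have "smooth_map_on A W (\<lambda>p. f p *\<^sub>R \<Phi> p (X p))"
    by (intro smooth_map_on_bilinear[OF manifold bounded_bilinear_scaleR] trivializationD(1)[OF W]
        sectionD(2)[OF assms(2) W] smooth_map_on_smooth_function[OF assms(1)])
  then show "smooth_map_on A W (\<lambda>p. \<Phi> p (f p *\<^sub>R X p))"
    by (rule smooth_map_on_cong[OF manifold trivializationD(1)[OF W]])
       (use linear_betweenD(3)[OF trivializationD(2)[OF W]] sectionD(1)[OF assms(2)] in simp)
qed

lemma sections_add:
  assumes "X \<in> sections A E" "Y \<in> sections A E"
  shows "(\<lambda>p. X p + Y p) \<in> sections A E"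
proof (rule sectionI)
  show "X p + Y p \<in> fibre E p" for p
    by (intro subspace_add subspace_fibre sectionD(1) assms)
  fix W \<Phi> assume W: "(W, \<Phi>) \<in> trivializations E"
  have "smooth_map_on A W (\<lambda>p. \<Phi> p (X p) + \<Phi> p (Y p))"
    by (intro smooth_map_on_add[OF manifold] trivializationD(1)[OF W] sectionD(2)[OF _ W] assms)
  then show "smooth_map_on A W (\<lambda>p. \<Phi> p (X p + Y p))"
    by (rule smooth_map_on_cong[OF manifold trivializationD(1)[OF W]])
       (use linear_betweenD(2)[OF trivializationD(2)[OF W]] sectionD(1) assms in simp)
qed

lemma sections_diff:
  assumes "X \<in> sections A E" "Y \<in> sections A E"
  shows "(\<lambda>p. X p - Y p) \<in> sections A E"
  using sections_add[OF assms(1)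
      sections_scale[OF smooth_functions_const[OF manifold, of "-1"] assms(2)]]
  by simp

text \<open>A local section with constant coordinates, cut off by a bump function.\<close>

lemma section_with_coordinates:
  assumes W: "(W, \<Phi>) \<in> trivializations E" "p \<in> W"
  obtains X \<rho> where "X \<in> sections A E" "\<rho> \<in> smooth_functions A" "\<rho> p \<noteq> 0"
    "\<And>q. q \<in> W \<Longrightarrow> \<Phi> q (X q) = \<rho> q *\<^sub>R w"
proof -
  have oW: "open W" by (rule trivializationD(1)[OF W(1)])
  obtain \<rho> C where \<rho>: "\<rho> \<in> smooth_functions A" "\<rho> p \<noteq> 0" "closed C" "C \<subseteq> W"
      "\<And>q. q \<notin> C \<Longrightarrow> \<rho> q = 0"
    by (rule smooth_functions_bump[OF manifold oW W(2)]) blast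
  define e where "e q = inv_into (fibre E q) (\<Phi> q) w" for q
  define X where "X q = (if q \<in> W then \<rho> q *\<^sub>R e q else 0)" for q
  have e: "e q \<in> fibre E q" "\<Phi> q (e q) = w" if "q \<in> W" for q
    using trivializationD(3)[OF W(1) that] unfolding e_def bij_betw_def
    by (auto intro: inv_into_into f_inv_into_f)
  have "X \<in> sections A E"
  proof (rule sectionI)
    show "X q \<in> fibre E q" for q
      using e(1) by (auto simp: X_def intro: subspace_scale subspace_0 subspace_fibre)
    fix W' \<Psi> assume W': "(W', \<Psi>) \<in> trivializations E"
    have o: "open W'" "open (W' \<inter> W)" using oW trivializationD(1)[OF W'] by auto
    have "smooth_map_on A (W' \<inter> W) (\<lambda>q. \<Psi> q (e q))"
      using trivializationD(4)[OF W(1) W'] by (simp add: e_def Int_commute)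
    then have "smooth_map_on A (W' \<inter> W) (\<lambda>q. \<rho> q *\<^sub>R \<Psi> q (e q))"
      by (rule smooth_map_on_bilinear[OF manifold bounded_bilinear_scaleR o(2)
            smooth_map_on_smooth_function[OF \<rho>(1)]])
    then have "smooth_map_on A (W' \<inter> W) (\<lambda>q. \<Psi> q (X q))"
      by (rule smooth_map_on_cong[OF manifold o(2)])
         (use linear_betweenD(3)[OF trivializationD(2)[OF W']] e(1) in \<open>simp add: X_def\<close>)
    then show "smooth_map_on A W' (\<lambda>q. \<Psi> q (X q))"
    proof (rule smooth_map_on_extend_zero[OF manifold o(1) oW \<rho>(3,4)])
      fix q assume "q \<in> W' - C"
      then show "\<Psi> q (X q) = 0"
        using linear_between_zero[OF trivializationD(2)[OF W'] subspace_fibre] \<rho>(5)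
        by (simp add: X_def)
    qed
  qed
  moreover have "\<Phi> q (X q) = \<rho> q *\<^sub>R w" if "q \<in> W" for q
    using that e[OF that] linear_betweenD(3)[OF trivializationD(2)[OF W(1) that]]
    by (simp add: X_def)
  ultimately show thesis using \<rho>(1,2) that by blast
qed

lemma section_through:
  assumes "v \<in> fibre E p"
  obtains X c where "X \<in> sections A E" "c \<noteq> 0" "X p = c *\<^sub>R v"
proof -
  obtain W \<Phi> where W: "(W, \<Phi>) \<in> trivializations E" "p \<in> W" using trivializations_cover by blast
  obtain X \<rho> where X: "X \<in> sections A E" "\<rho> p \<noteq> 0"
    "\<And>q. q \<in> W \<Longrightarrow> \<Phi> q (X q) = \<rho> q *\<^sub>R \<Phi> p v"
    by (rule section_with_coordinates[OF W]) blast
  have "\<Phi> p (X p) = \<Phi> p (\<rho> p *\<^sub>R v)"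
    using X(3)[OF W(2)] linear_betweenD(3)[OF trivializationD(2)[OF W] assms] by simp
  then have "X p = \<rho> p *\<^sub>R v"
    using trivializationD(3)[OF W] sectionD(1)[OF X(1)] subspace_scale[OF subspace_fibre assms]
    by (auto simp: bij_betw_def dest: inj_onD)
  with X(1,2) show thesis by (rule that)
qed

text \<open>A coefficient that multiplies sections to sections is smooth when the rank is positive: near
  any point it is the quotient of a coordinate of \<open>F X\<close> by the same coordinate of \<open>X\<close>, for a
  section \<open>X\<close> with coordinates \<open>\<rho> w\<close>.\<close>

lemma smooth_function_if_scales_sections:
  fixes w :: 'f
  assumes "w \<noteq> 0" "\<And>Y. Y \<in> sections A E \<Longrightarrow> (\<lambda>p. F p *\<^sub>R Y p) \<in> sections A E"
  shows "F \<in> smooth_functions A"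
proof -
  have "smooth_map_on A UNIV F"
  proof (rule smooth_map_on_local[OF manifold open_UNIV])
    fix p :: 'm
    obtain W \<Phi> where W: "(W, \<Phi>) \<in> trivializations E" "p \<in> W" using trivializations_cover by blast
    obtain X \<rho> where X: "X \<in> sections A E" "\<rho> \<in> smooth_functions A" "\<rho> p \<noteq> 0"
      "\<And>q. q \<in> W \<Longrightarrow> \<Phi> q (X q) = \<rho> q *\<^sub>R w"
      by (rule section_with_coordinates[OF W]) blast
    define N where "N = W \<inter> \<rho> -` (- {0})"
    define g where "g q = inverse (\<rho> q) * (\<Phi> q (F q *\<^sub>R X q) \<bullet> ((1 / (w \<bullet> w)) *\<^sub>R w))" for q
    have "open (\<rho> -` (- {0}))"
      by (intro open_vimage smooth_functions_continuous[OF manifold] X(2)) auto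
    then have N: "open N" "p \<in> N" "N \<subseteq> W"
      using X(3) W trivializationD(1)[OF W(1)] by (auto simp: N_def)
    have "smooth_map_on A N \<rho>"
      by (rule smooth_map_on_smooth_function[OF X(2)])
    moreover have "smooth_on (- {0}) (inverse :: real \<Rightarrow> real)"
      using Ck_on_inverse[of "- {0}"] by (auto simp: smooth_on_def)
    moreover have "open (- {0 :: real})" "\<rho> ` N \<subseteq> - {0}" by (auto simp: N_def)
    ultimately have "smooth_map_on A N (\<lambda>q. inverse (\<rho> q))"
      using smooth_map_on_compose[OF manifold finite_dimensional_real N(1)] by blast
    moreover have "smooth_map_on A N (\<lambda>q. \<Phi> q (F q *\<^sub>R X q))"
      using sectionD(2)[OF assms(2)[OF X(1)] W(1)] N(3) by (rule smooth_map_on_subset)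
    ultimately have "smooth_map_on A N g"
      unfolding g_def
      by (intro smooth_map_on_bilinear[OF manifold bounded_bilinear_mult N(1)]
          smooth_map_on_bilinear[OF manifold bounded_bilinear_inner N(1)]
          smooth_map_on_const[OF manifold N(1)])
    moreover have "g q = F q" if "q \<in> N" for q
    proof -
      have q: "q \<in> W" "\<rho> q \<noteq> 0" using that by (auto simp: N_def)
      have "\<Phi> q (F q *\<^sub>R X q) = F q *\<^sub>R (\<rho> q *\<^sub>R w)"
        using X(4)[OF q(1)] linear_betweenD(3)[OF trivializationD(2)[OF W(1) q(1)]]
          sectionD(1)[OF X(1)]
        by simp
      then show ?thesis using q(2) assms(1) by (simp add: g_def)
    qed
    ultimately show "\<exists>N g. open N \<and> p \<in> N \<and> N \<subseteq> UNIV \<and> smooth_map_on A N g \<and> (\<forall>r\<in>N. g r = F r)"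
      using N by blast
  qed
  then show ?thesis by (simp add: smooth_functions_def)
qed

end

section \<open>Loday algebroids\<close>

lemma loday_algebroidD:
  assumes "loday_algebroid A E br al ar"
  shows loday_algebroid_vector_bundle: "vector_bundle A E"
    and left_anchor_linear: "linear_between (fibre E p) UNIV (al p)"
    and right_anchor_linear: "linear_between (fibre E p) UNIV (ar p)"
  using assms unfolding loday_algebroid_def algebroid_def bundle_morphism_def
  by (auto simp: tangent_bundle_def)

text \<open>The derivative of \<open>g\<close> along an anchored section is smooth because of the Leibniz rule:
  \<open>L X g\<close> times \<open>Y\<close> equals \<open>br X (g Y) - g (br X Y)\<close>, which is a section for every
  \<open>Y\<close>. The vector \<open>w\<close> witnesses that the rank is positive, which gives the nonvanishing sections.\<close>

lemma loday_pseudoalgebra_sections: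
  fixes A :: "('m::{t2_space, second_countable_topology}, 'e::real_inner) chart set"
    and E :: "('m, 'v::real_vector, 'f::real_inner) vbundle" and w :: 'f
  assumes manifold: "smooth_manifold A" and loday: "loday_algebroid A E br al ar" and "w \<noteq> 0"
  shows "loday_pseudoalgebra (smooth_functions A) (sections A E) br
    (\<lambda>X. lie_derivative A (\<lambda>q. al q (X q))) (\<lambda>X. lie_derivative A (\<lambda>q. ar q (X q)))"
    (is "loday_pseudoalgebra ?C ?\<Gamma> br ?L ?R")
proof -
  note E = loday_algebroid_vector_bundle[OF loday]
    and al = left_anchor_linear[OF loday] and ar = right_anchor_linear[OF loday]
  have bilinear: "bilinear_bracket ?\<Gamma> br"
    and leibniz: "\<And>X Y f g. X \<in> ?\<Gamma> \<Longrightarrow> Y \<in> ?\<Gamma> \<Longrightarrow> f \<in> ?C \<Longrightarrow> g \<in> ?C \<Longrightarrow>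
        br (\<lambda>p. f p *\<^sub>R X p) (\<lambda>p. g p *\<^sub>R Y p) =
          (\<lambda>p. (f p * g p) *\<^sub>R br X Y p + (f p * ?L X g p) *\<^sub>R Y p - (g p * ?R Y f p) *\<^sub>R X p)"
    using loday unfolding loday_algebroid_def algebroid_def by auto
  note fibre = sectionD(1)[OF manifold E] subspace_fibre[OF manifold E]
  note scale = sections_scale[OF manifold E] and diff = sections_diff[OF manifold E]
    and const = smooth_functions_const[OF manifold]
  have closed: "br X Y \<in> ?\<Gamma>" if "X \<in> ?\<Gamma>" "Y \<in> ?\<Gamma>" for X Y
    using bilinear that by (simp add: bilinear_bracket_def)
  have add: "br (\<lambda>p. X p + Y p) Z = (\<lambda>p. br X Z p + br Y Z p)"
      "br Z (\<lambda>p. X p + Y p) = (\<lambda>p. br Z X p + br Z Y p)"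
    if "X \<in> ?\<Gamma>" "Y \<in> ?\<Gamma>" "Z \<in> ?\<Gamma>" for X Y Z
    using bilinear that by (simp_all add: bilinear_bracket_def)
  have neg: "br (\<lambda>p. - Y p) Z = (\<lambda>p. - br Y Z p)" "br Z (\<lambda>p. - Y p) = (\<lambda>p. - br Z Y p)"
    if "Y \<in> ?\<Gamma>" "Z \<in> ?\<Gamma>" for Y Z
  proof -
    have "br (\<lambda>p. c *\<^sub>R Y p) Z = (\<lambda>p. c *\<^sub>R br Y Z p)" "br Z (\<lambda>p. c *\<^sub>R Y p) = (\<lambda>p. c *\<^sub>R br Z Y p)"
      for c using bilinear that by (simp_all add: bilinear_bracket_def)
    from this(1)[of "-1"] this(2)[of "-1"]
    show "br (\<lambda>p. - Y p) Z = (\<lambda>p. - br Y Z p)" "br Z (\<lambda>p. - Y p) = (\<lambda>p. - br Z Y p)" by simp_all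
  qed
  have neg_closed: "(\<lambda>p. - Y p) \<in> ?\<Gamma>" if "Y \<in> ?\<Gamma>" for Y
    using scale[OF const[of "-1"] that] by simp
  have right: "br X (\<lambda>p. g p *\<^sub>R Y p) = (\<lambda>p. g p *\<^sub>R br X Y p + ?L X g p *\<^sub>R Y p)"
    if "X \<in> ?\<Gamma>" "Y \<in> ?\<Gamma>" "g \<in> ?C" for X Y g
    using leibniz[OF that(1,2) const[of 1] that(3)]
    by (simp add: lie_derivative_def tangent_map_const[OF manifold])
  have left: "br (\<lambda>p. f p *\<^sub>R X p) Y = (\<lambda>p. f p *\<^sub>R br X Y p - ?R Y f p *\<^sub>R X p)"
    if "X \<in> ?\<Gamma>" "Y \<in> ?\<Gamma>" "f \<in> ?C" for X Y f
    using leibniz[OF that(1,2,3) const[of 1]]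
    by (simp add: lie_derivative_def tangent_map_const[OF manifold])
  note smoothI = smooth_function_if_scales_sections[OF manifold E \<open>w \<noteq> 0\<close>]
  show ?thesis
  proof
    fix f g X Y Z p
    assume C: "f \<in> ?C" "g \<in> ?C"
    show "(\<lambda>p. f p * g p) \<in> ?C" by (rule smooth_functions_mult[OF manifold C])
    show "?L X (\<lambda>p. f p * g p) p = f p * ?L X g p + g p * ?L X f p"
      "?R X (\<lambda>p. f p * g p) p = f p * ?R X g p + g p * ?R X f p"
      "?L X (\<lambda>p. f p + g p) p = ?L X f p + ?L X g p"
      "?R X (\<lambda>p. f p + g p) p = ?R X f p + ?R X g p"
      using C by (simp_all add: lie_derivative_def tangent_map_mult[OF manifold]
          tangent_map_add[OF manifold])
    assume X: "X \<in> ?\<Gamma>"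
    show "?L (\<lambda>p. f p *\<^sub>R X p) g p = f p * ?L X g p"
      by (simp add: lie_derivative_def linear_betweenD(3)[OF al fibre(1)[OF X]]
          linear_cmul[OF tangent_map_linear[OF manifold C(2)]])
  next
    fix f X assume "f \<in> ?C" "X \<in> ?\<Gamma>"
    then show "(\<lambda>p. f p *\<^sub>R X p) \<in> ?\<Gamma>" by (rule scale)
  next
    fix X Y assume XY: "X \<in> ?\<Gamma>" "Y \<in> ?\<Gamma>"
    then show "br X Y \<in> ?\<Gamma>" by (rule closed)
    fix g p assume "g \<in> ?C"
    then show "?L (\<lambda>p. X p - Y p) g p = ?L X g p - ?L Y g p"
      using XY by (simp add: lie_derivative_def linear_between_diff[OF al fibre(2) fibre(1) fibre(1)]
          linear_diff[OF tangent_map_linear[OF manifold]])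
  next
    fix X Y Z assume XYZ: "X \<in> ?\<Gamma>" "Y \<in> ?\<Gamma>" "Z \<in> ?\<Gamma>"
    show "br (\<lambda>p. X p - Y p) Z = (\<lambda>p. br X Z p - br Y Z p)"
      using add(1)[OF XYZ(1) neg_closed[OF XYZ(2)] XYZ(3)] neg(1)[OF XYZ(2,3)] by simp
    show "br Z (\<lambda>p. X p - Y p) = (\<lambda>p. br Z X p - br Z Y p)"
      using add(2)[OF XYZ(1) neg_closed[OF XYZ(2)] XYZ(3)] neg(2)[OF XYZ(2,3)] by simp
    show "br Z (\<lambda>p. X p + Y p) = (\<lambda>p. br Z X p + br Z Y p)" by (rule add(2)[OF XYZ])
    show "br X (br Y Z) = (\<lambda>p. br (br X Y) Z p + br Y (br X Z) p)"
      using loday XYZ unfolding loday_algebroid_def by blast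
  next
    fix g X Y assume "g \<in> ?C" "X \<in> ?\<Gamma>" "Y \<in> ?\<Gamma>"
    then show "br X (\<lambda>p. g p *\<^sub>R Y p) = (\<lambda>p. g p *\<^sub>R br X Y p + ?L X g p *\<^sub>R Y p)"
      "br (\<lambda>p. g p *\<^sub>R X p) Y = (\<lambda>p. g p *\<^sub>R br X Y p - ?R Y g p *\<^sub>R X p)"
      by (simp_all add: right left)
  next
    fix X g assume X: "X \<in> ?\<Gamma>" and g: "g \<in> ?C"
    show "?L X g \<in> ?C"
    proof (rule smoothI)
      fix Y assume Y: "Y \<in> ?\<Gamma>"
      have "(\<lambda>p. br X (\<lambda>p. g p *\<^sub>R Y p) p - g p *\<^sub>R br X Y p) \<in> ?\<Gamma>"
        by (intro diff scale closed X Y g)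
      then show "(\<lambda>p. ?L X g p *\<^sub>R Y p) \<in> ?\<Gamma>" by (simp add: right X Y g)
    qed
    show "?R X g \<in> ?C"
    proof (rule smoothI)
      fix Y assume Y: "Y \<in> ?\<Gamma>"
      have "(\<lambda>p. g p *\<^sub>R br Y X p - br (\<lambda>p. g p *\<^sub>R Y p) X p) \<in> ?\<Gamma>"
        by (intro diff scale closed X Y g)
      then show "(\<lambda>p. ?R X g p *\<^sub>R Y p) \<in> ?\<Gamma>" by (simp add: left X Y g)
    qed
  next
    fix p
    obtain W \<Phi> where W: "(W, \<Phi>) \<in> trivializations E" "p \<in> W"
      using trivializations_cover[OF manifold E] by blast
    obtain X \<rho> where X: "X \<in> ?\<Gamma>" "\<rho> p \<noteq> 0" "\<And>q. q \<in> W \<Longrightarrow> \<Phi> q (X q) = \<rho> q *\<^sub>R w"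
      by (rule section_with_coordinates[OF manifold E W, of w]) blast
    have "\<Phi> p (X p) \<noteq> \<Phi> p 0"
      using X(2,3) W(2) \<open>w \<noteq> 0\<close>
        linear_between_zero[OF trivializationD(2)[OF manifold E W] fibre(2)] by simp
    then show "\<exists>Z\<in>?\<Gamma>. Z p \<noteq> 0" using X(1) by metis
  qed
qed

theorem theorem3:
  fixes A :: "('m::{t2_space, second_countable_topology}, 'e::real_inner) chart set"
    and E :: "('m, 'v::real_vector, 'f::real_inner) vbundle"
    and br :: "('m \<Rightarrow> 'v) \<Rightarrow> ('m \<Rightarrow> 'v) \<Rightarrow> 'm \<Rightarrow> 'v"
    and al ar :: "'m \<Rightarrow> 'v \<Rightarrow> 'e"
  assumes "smooth_manifold A"
    and "loday_algebroid A E br al ar"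
  shows "(\<forall>p. \<forall>v\<in>fibre E p. al p v = ar p v) \<and>
    (\<forall>p. (\<exists>v\<in>fibre E p. al p v \<noteq> 0) \<longrightarrow>
       (\<forall>X\<in>sections A E. \<forall>Y\<in>sections A E. br X Y p = - br Y X p))"
proof -
  note E = loday_algebroid_vector_bundle[OF assms(2)]
    and al = left_anchor_linear[OF assms(2)] and ar = right_anchor_linear[OF assms(2)]
  show ?thesis
  proof (cases "\<exists>w :: 'f. w \<noteq> 0")
    case False
    \<comment> \<open>In rank zero all fibres are trivial and both anchors vanish.\<close>
    have zero: "v = 0" if "v \<in> fibre E p" for p v
    proof -
      obtain W \<Phi> where W: "(W, \<Phi>) \<in> trivializations E" "p \<in> W"
        using trivializations_cover[OF assms(1) E] by blast
      have "\<Phi> p v = \<Phi> p 0" using False by metis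
      then show ?thesis
        using trivializationD(3)[OF assms(1) E W] that subspace_0[OF subspace_fibre[OF assms(1) E]]
        by (auto simp: bij_betw_def dest: inj_onD)
    qed
    have "al p v = 0 \<and> ar p v = 0" if "v \<in> fibre E p" for p v
      using zero[OF that] linear_between_zero[OF al subspace_fibre[OF assms(1) E]]
        linear_between_zero[OF ar subspace_fibre[OF assms(1) E]] by simp
    then show ?thesis by simp
  next
    case True
    then obtain w :: 'f where "w \<noteq> 0" by blast
    interpret loday_pseudoalgebra "smooth_functions A" "sections A E" br
      "\<lambda>X. lie_derivative A (\<lambda>q. al q (X q))" "\<lambda>X. lie_derivative A (\<lambda>q. ar q (X q))"
      by (rule loday_pseudoalgebra_sections[OF assms \<open>w \<noteq> 0\<close>])
    \<comment> \<open>A section through \<open>v\<close> and a function whose differential pairs with \<open>u\<close> reduce statements about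
      vectors to statements about real numbers.\<close>
    have detect: "\<exists>X\<in>sections A E. \<exists>g\<in>smooth_functions A. \<exists>c. c \<noteq> 0 \<and>
        lie_derivative A (\<lambda>q. al q (X q)) g p = c * (al p v \<bullet> u) \<and>
        lie_derivative A (\<lambda>q. ar q (X q)) g p = c * (ar p v \<bullet> u)" if v: "v \<in> fibre E p" for p v u
    proof -
      obtain X c where X: "X \<in> sections A E" "c \<noteq> 0" "X p = c *\<^sub>R v"
        by (rule section_through[OF assms(1) E v]) blast
      obtain g d where g: "g \<in> smooth_functions A" "d \<noteq> 0"
          "\<And>y. tangent_map A p g y = d * (y \<bullet> u)"
        by (rule smooth_function_with_differential[OF assms(1), of p u]) blast
      have "al p (X p) = c *\<^sub>R al p v" "ar p (X p) = c *\<^sub>R ar p v"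
        using X(3) linear_betweenD(3)[OF al v] linear_betweenD(3)[OF ar v] by simp_all
      then show ?thesis
        using X(1,2) g by (intro bexI[of _ X] bexI[of _ g] exI[of _ "d * c"])
          (auto simp: lie_derivative_def)
    qed
    have "al p v = ar p v" if v: "v \<in> fibre E p" for p v
    proof -
      let ?u = "al p v - ar p v"
      obtain X g c where "X \<in> sections A E" "g \<in> smooth_functions A" "c \<noteq> 0"
        "lie_derivative A (\<lambda>q. al q (X q)) g p = c * (al p v \<bullet> ?u)"
        "lie_derivative A (\<lambda>q. ar q (X q)) g p = c * (ar p v \<bullet> ?u)"
        using detect[OF v, of ?u] by blast
      then have "al p v \<bullet> ?u = ar p v \<bullet> ?u" using left_anchor_eq_right_anchor[of X g p] by simp
      then have "?u \<bullet> ?u = 0" by (simp add: inner_diff_left)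
      then show ?thesis by simp
    qed
    moreover have "br X Y p = - br Y X p"
      if v: "v \<in> fibre E p" "al p v \<noteq> 0" and XY: "X \<in> sections A E" "Y \<in> sections A E"
      for p v X Y
    proof -
      obtain Z g c where "Z \<in> sections A E" "g \<in> smooth_functions A" "c \<noteq> 0"
        "lie_derivative A (\<lambda>q. al q (Z q)) g p = c * (al p v \<bullet> al p v)"
        using detect[OF v(1), of "al p v"] by blast
      then show ?thesis using skew_symmetric_or_anchor_vanishes[OF XY, of Z g p] v(2) by simp
    qed
    ultimately show ?thesis by blast
  qed
qed

end
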